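(* Let $G=(\Lambda,\{S^i\}_{i\in\Lambda},\{F^i\}_{i\in\Lambda})$ be a multiobjective interval-valued noncooperative game with $\Lambda=\{1,\dots,l\}$, strategy sets $S^i=\{u\in\mathbb{R}^n:g^i_j(u)\le0,\ j\in J\}$, $J=\{1,\dots,p\}$, and loss functions $F^i=(F^i_1,\dots,F^i_m)$, $K=\{1,\dots,m\}$. Let $\varepsilon=(\varepsilon_1,\dots,\varepsilon_m)\in\mathbb{R}^m_+\setminus\{0\}$ and let $\overline{u}=(\overline{u}_1,\dots,\overline{u}_l)\in\widehat{S}=\prod_{i\in\Lambda}S^i$ be a weak $\varepsilon$-quasi Nash equilibrium of $G$. Suppose that for each $i\in\Lambda$, $F^i_k(\cdot,\overline{u}_{-i})$ and $g^i_j$ are locally Lipschitz continuous on $\mathbb{R}^n$ for all $k\in K$ and $j\in J$. Moreover, suppose that BCQ holds (for the constraints $g^i_j$) at $\overline{u}_i\in S^i$ for all $i\in\Lambda$. Then, for every $i\in\Lambda$, there exist $\lambda^i=(\lambda^i_1,\dots,\lambda^i_m)\in\mathbb{R}^m_+$ with $\sum_{k\in K}\lambda^i_k=1$ and $\mu^i=(\mu^i_1,\dots,\mu^i_p)\in\mathbb{R}^p_+$ such that $$0\in\sum_{k\in K}\lambda^i_k\partial^0 F^i_k(\overline{u}_i,\overline{u}_{-i})+\sum_{j\in I(\overline{u}_i)}\mu^i_j\partial^0 g^i_j(\overline{u}_i)+\sum_{k\in K}\lambda^i_k\varepsilon_k \mathbb{B}^n,\qquad \mu^i_jg^i_j(\overline{u}_i)=0\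 \ \forall j\in J.$$
   Context: $\mathcal{I}$ is the set of all compact intervals $[\underline q,\overline q]$ with $\underline q\le\overline q$ real. For $Q=[\underline q,\overline q]\in\mathcal I$ put $q^c=\frac{\underline q+\overline q}{2}$ and $q^w=\frac{\overline q-\underline q}{2}$. Addition: $[\underline q,\overline q]+[\underline r,\overline r]=[\underline q+\underline r,\overline q+\overline r]$. Order: $Q\prec_{CW}R$ iff $q^c<r^c$ and $q^w<r^w$. $\mathbb{R}^m_+$ is the nonnegative orthant; $\mathbb{B}^n$ is the closed unit ball of $\mathbb{R}^n$; $\mathrm{co}$ denotes convex hull. An interval-valued function $f=[\underline f,\overline f]:\mathbb{R}^n\to\mathcal I$ is locally Lipschitz continuous if every point has a neighbourhood $U$ and $L>0$ with $\max\{|\underline f(u_1)-\underline f(u_2)|,|\overline f(u_1)-\overline f(u_2)|\}\le L\|u_1-u_2\|$ for $u_1,u_2\in U$. Write $f^c=\frac{\underline f+\overline f}{2}$, $f^w=\frac{\overline f-\underline f}{2}$. For locally Lipschitz $\psi:\mathbb{R}^n\to\mathbb{R}$, $\psi^0(z;w)=\limsup_{u\to z,\,t\to0^+}\frac{\psi(u+tw)-\psi(u)}{t}$ and $\partial^0\psi(z)=\{z^*:\langle z^*,w\rangle\le\psi^0(z;w)\ \forall w\in\mathbb{R}^n\}$ (Clarke gradient). For locally Lipschitz interval-valued $f$, $\partial^0f(u):=\mathrm{co}(\partial^0f^c(u)\cup\partial^0f^w(u))$. Game: $g^i_j:\mathbb{R}^n\to\mathbb{R}$; each $F^i_k$ is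 an $\mathcal I$-valued function of strategy profiles $u=(u_1,\dots,u_l)$. For a profile $\overline u$, $\overline u_{-i}$ is $\overline u$ with the $i$-th component removed, and $(u_i,\overline u_{-i})$ is $\overline u$ with the $i$-th component replaced by $u_i$. For fixed $\overline u_{-i}$, $F^i_k(\cdot,\overline u_{-i})$ is regarded as defined on all of $\mathbb{R}^n$, and $\partial^0F^i_k(x,\overline u_{-i})$ is the gradient at $x$ of $F^i_k(\cdot,\overline u_{-i})$. $\overline u\in\widehat S$ is a weak $\varepsilon$-quasi Nash equilibrium if for every $i\in\Lambda$ there is no $y_i\in S^i$ with $F^i_k(y_i,\overline u_{-i})+[0,\varepsilon_k\|\overline u_i-y_i\|]\prec_{CW}F^i_k(\overline u)$ for all $k\in K$. For $x\in S^i$, $I(x):=\{j\in J:g^i_j(x)=0\}$. BCQ holds at $x\in S^i$ if there is no $\mu\in\mathbb{R}^p_+\setminus\{0\}$ with $\mu_j\ge0$ for $j\in I(x)$, $\mu_j=0$ for $j\notin I(x)$ and $0\in\sum_{j\in J}\mu_j\partial^0g^i_j(x)$. A sum over an empty index set is $\{0\}$. *)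

theory Defs
  imports "HOL-Analysis.Analysis" "HOL-Library.Interval"
begin

text \<open>
  The set \<open>\<I>\<close> of compact real intervals is the type \<^typ>\<open>real interval\<close>; its addition is the
  endpointwise one.  Its built-in order is inclusion, so the order \<open>\<prec>\<^sub>C\<^sub>W\<close> is defined separately.
\<close>

definition center :: "real interval \<Rightarrow> real" where
  "center Q = (lower Q + upper Q) / 2"

definition half_width :: "real interval \<Rightarrow> real" where
  "half_width Q = (upper Q - lower Q) / 2"

definition cw_less :: "real interval \<Rightarrow> real interval \<Rightarrow> bool" (infix "\<prec>\<^sub>C\<^sub>W" 50) where
  "Q \<prec>\<^sub>C\<^sub>W R \<longleftrightarrow> center Q < center R \<and> half_width Q < half_width R"

definition locally_Lipschitz :: "('a::metric_space \<Rightarrow> real) \<Rightarrow> bool" where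
  "locally_Lipschitz f \<longleftrightarrow>
     (\<forall>x. \<exists>U L. open U \<and> x \<in> U \<and> 0 < L \<and> L-lipschitz_on U f)"

definition locally_Lipschitz_ivl :: "('a::real_normed_vector \<Rightarrow> real interval) \<Rightarrow> bool" where
  "locally_Lipschitz_ivl f \<longleftrightarrow>
     (\<forall>x. \<exists>U L. open U \<and> x \<in> U \<and> 0 < L \<and>
        (\<forall>u\<^sub>1\<in>U. \<forall>u\<^sub>2\<in>U.
           max \<bar>lower (f u\<^sub>1) - lower (f u\<^sub>2)\<bar> \<bar>upper (f u\<^sub>1) - upper (f u\<^sub>2)\<bar>
             \<le> L * norm (u\<^sub>1 - u\<^sub>2)))"

text \<open>
  The upper limit is taken in the extended reals, so it needs no boundedness assumption; it is
  finite for locally Lipschitz \<open>\<psi>\<close>.  As usual for Clarke's derivative, \<open>u\<close> may equal \<open>z\<close>.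
\<close>

definition clarke_deriv :: "('a::real_normed_vector \<Rightarrow> real) \<Rightarrow> 'a \<Rightarrow> 'a \<Rightarrow> ereal" where
  "clarke_deriv \<psi> z w =
     Limsup (nhds z \<times>\<^sub>F at_right 0) (\<lambda>(u, t). ereal ((\<psi> (u + t *\<^sub>R w) - \<psi> u) / t))"

definition clarke_grad :: "('a::real_inner \<Rightarrow> real) \<Rightarrow> 'a \<Rightarrow> 'a set" where
  "clarke_grad \<psi> z = {z'. \<forall>w. ereal (inner z' w) \<le> clarke_deriv \<psi> z w}"

definition clarke_grad_ivl :: "('a::real_inner \<Rightarrow> real interval) \<Rightarrow> 'a \<Rightarrow> 'a set" where
  "clarke_grad_ivl f u =
     convex hull (clarke_grad (\<lambda>x. center (f x)) u \<union> clarke_grad (\<lambda>x. half_width (f x)) u)"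

definition feasible_set :: "nat set \<Rightarrow> (nat \<Rightarrow> 'a \<Rightarrow> real) \<Rightarrow> 'a set" where
  "feasible_set J g = {x. \<forall>j\<in>J. g j x \<le> 0}"

definition active_set :: "nat set \<Rightarrow> (nat \<Rightarrow> 'a \<Rightarrow> real) \<Rightarrow> 'a \<Rightarrow> nat set" where
  "active_set J g x = {j\<in>J. g j x = 0}"

text \<open>
  Sums of sets are Minkowski sums (\<^theory>\<open>HOL-Library.Set_Algebras\<close>), with empty sum \<open>{0}\<close>.
\<close>

definition BCQ :: "nat set \<Rightarrow> (nat \<Rightarrow> 'a::real_inner \<Rightarrow> real) \<Rightarrow> 'a \<Rightarrow> bool" where
  "BCQ J g x \<longleftrightarrow>
     \<not> (\<exists>\<mu> :: nat \<Rightarrow> real.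
          (\<forall>j\<in>J. 0 \<le> \<mu> j) \<and> (\<exists>j\<in>J. \<mu> j \<noteq> 0) \<and>
          (\<forall>j\<in>J - active_set J g x. \<mu> j = 0) \<and>
          0 \<in> (\<Sum>j\<in>J. (*\<^sub>R) (\<mu> j) ` clarke_grad (g j) x))"

text \<open>
  A profile is a function on the players, \<open>u(i := y)\<close> being \<open>(y, u\<^sub>-\<^sub>i)\<close>; the library's
  extensional product \<^const>\<open>PiE\<close> fixes its values outside the player set.
  The term \<open>Interval (0, c)\<close> denotes \<open>[0, c]\<close> only for \<open>c \<ge> 0\<close>, that is, for nonnegative \<open>\<epsilon>\<close>.
\<close>

definition weak_quasi_Nash ::
  "nat set \<Rightarrow> nat set \<Rightarrow> (nat \<Rightarrow> 'a::real_normed_vector set) \<Rightarrow>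
   (nat \<Rightarrow> nat \<Rightarrow> (nat \<Rightarrow> 'a) \<Rightarrow> real interval) \<Rightarrow> (nat \<Rightarrow> real) \<Rightarrow> (nat \<Rightarrow> 'a) \<Rightarrow> bool" where
  "weak_quasi_Nash \<Lambda> K S F \<epsilon> u \<longleftrightarrow>
     u \<in> PiE \<Lambda> S \<and>
     (\<forall>i\<in>\<Lambda>. \<not> (\<exists>y\<in>S i. \<forall>k\<in>K.
        F i k (u(i := y)) + Interval (0, \<epsilon> k * norm (u i - y)) \<prec>\<^sub>C\<^sub>W F i k u))"

end

theory Submission
  imports Defs
begin

text \<open>
  By continuity only the active constraints matter near \<open>u i\<close>, so quasi-optimality says that at every
  nearby point some function among \<open>F\<^sup>c\<^sub>k + (\<epsilon>\<^sub>k/2) \<parallel>\<cdot> - u i\<parallel>\<close>, \<open>F\<^sup>w\<^sub>k + (\<epsilon>\<^sub>k/2) \<parallel>\<cdot> - u i\<parallel>\<close>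
  and \<open>g\<^sub>j\<close> (\<open>j\<close> active) is at least its value at \<open>u i\<close>.  (The interval \<open>[0, c]\<close> has centre and half-width \<open>c/2\<close>,
  whence \<open>\<epsilon>\<^sub>k/2\<close>.)  If \<open>0\<close> were outside the convex hull of the sets `Clarke gradient plus ball' of
  these functions, a separating direction would make all of them decrease strictly, because Clarke's
  directional derivative is the support function of the Clarke gradient (Hahn--Banach).  The
  resulting multipliers are normalised on the objectives; BCQ excludes that those all vanish.
  Neither a sum rule nor a maximum rule for Clarke gradients is needed.
\<close>

section \<open>Clarke's directional derivative as an upper limit\<close>

lemma clarke_deriv_lessD:
  assumes "clarke_deriv \<psi> z w < ereal c"
  shows "\<forall>\<^sub>F (u, t) in nhds z \<times>\<^sub>F at_right 0. (\<psi> (u + t *\<^sub>R w) - \<psi> u) / t < c"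
  using Limsup_lessD[OF assms[unfolded clarke_deriv_def]]
  by (simp add: case_prod_unfold)

lemma clarke_deriv_leI:
  assumes "\<And>y. c < y \<Longrightarrow>
    \<forall>\<^sub>F (u, t) in nhds z \<times>\<^sub>F at_right 0. (\<psi> (u + t *\<^sub>R w) - \<psi> u) / t < y"
  shows "clarke_deriv \<psi> z w \<le> ereal c"
  unfolding clarke_deriv_def
proof (subst Limsup_le_iff, intro allI impI)
  fix y :: ereal
  assume "ereal c < y"
  \<comment> \<open>The bound \<open>y\<close> may be infinite, so a real number above
    \<open>c\<close> is inserted below it.\<close>
  then obtain r where r: "c < r" "ereal r \<le> y"
    by (metis ereal_dense2 less_imp_le less_ereal.simps(1))
  show "\<forall>\<^sub>F x in nhds z \<times>\<^sub>F at_right 0.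
      (case x of (u, t) \<Rightarrow> ereal ((\<psi> (u + t *\<^sub>R w) - \<psi> u) / t)) < y"
    using assms[OF r(1)]
    by eventually_elim (clarsimp, rule less_le_trans[OF _ r(2)], simp)
qed

text \<open>Allows the base point \<open>u\<close> of a difference quotient to be moved to
  \<open>u + t *\<^sub>R w\<close> without leaving the limit process at \<open>z\<close>.\<close>

lemma tendsto_shift:
  fixes z w :: "'a::real_normed_vector"
  shows "((\<lambda>(u, t). u + t *\<^sub>R w) \<longlongrightarrow> z) (nhds z \<times>\<^sub>F at_right 0)"
proof -
  have 1: "(fst \<longlongrightarrow> z) (nhds z \<times>\<^sub>F at_right (0::real))"
    by (rule filterlim_fst)
  have "(snd \<longlongrightarrow> (0::real)) (nhds z \<times>\<^sub>F at_right 0)"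
    by (rule filterlim_mono[OF filterlim_snd at_within_le_nhds order_refl])
  from tendsto_add[OF 1 tendsto_scaleR[OF this tendsto_const[of w]]]
  show ?thesis by (simp add: case_prod_unfold)
qed

lemma eventually_snd_pos: "\<forall>\<^sub>F (u, t) in nhds z \<times>\<^sub>F at_right (0::real). 0 < t"
  using filterlim_snd[of "at_right (0::real)" "nhds z", unfolded filterlim_iff, rule_format,
      OF eventually_at_right_less]
  by (simp add: case_prod_unfold)

lemma prod_nhds_at_right_neq_bot: "nhds z \<times>\<^sub>F at_right (0::real) \<noteq> bot"
  by (simp add: prod_filter_eq_bot)

text \<open>Both ends of the segment from \<open>u\<close> to \<open>u + t *\<^sub>R w\<close> are
  eventually in \<open>U\<close>, so the Lipschitz estimate bounds every quotient. This finiteness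
  justifies passing to a real-valued derivative.\<close>

lemma clarke_deriv_bounded:
  assumes "open U" "z \<in> U" "L-lipschitz_on U \<psi>"
  shows "\<bar>clarke_deriv \<psi> z w\<bar> \<le> ereal (L * norm w)"
proof -
  have inU: "\<forall>\<^sub>F (u, t) in nhds z \<times>\<^sub>F at_right 0. u + t *\<^sub>R w \<in> U" for w
    using topological_tendstoD[OF tendsto_shift assms(1,2), of w] by (simp add: case_prod_unfold)
  have ev: "\<forall>\<^sub>F (u, t) in nhds z \<times>\<^sub>F at_right 0. - (L * norm w) \<le> (\<psi> (u + t *\<^sub>R w) - \<psi> u) / t \<and>
      (\<psi> (u + t *\<^sub>R w) - \<psi> u) / t \<le> L * norm w"
    \<comment> \<open>The direction 0 gives membership of the base point \<open>u\<close>
      itself.\<close>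
    using inU[of 0] inU[of w] eventually_snd_pos
  proof eventually_elim
    case (elim x)
    obtain u t where x: "x = (u, t)" by fastforce
    have t: "0 < t" and "\<bar>\<psi> (u + t *\<^sub>R w) - \<psi> u\<bar> \<le> L * (t * norm w)"
      using elim lipschitz_onD[OF assms(3), of "u + t *\<^sub>R w" u] by (auto simp: x dist_norm)
    then have "\<bar>(\<psi> (u + t *\<^sub>R w) - \<psi> u) / t\<bar> \<le> L * norm w"
      by (simp add: divide_le_eq mult_ac)
    then show ?case unfolding x prod.case by linarith
  qed
  have "clarke_deriv \<psi> z w \<le> ereal (L * norm w)"
    unfolding clarke_deriv_def
    by (rule Limsup_bounded, rule eventually_mono[OF ev]) auto
  \<comment> \<open>An eventual lower bound passes to the upper limit because the filter is
    nontrivial.\<close>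
  moreover have "ereal (- (L * norm w)) \<le> clarke_deriv \<psi> z w"
    unfolding clarke_deriv_def
    by (rule le_Limsup[OF prod_nhds_at_right_neq_bot], rule eventually_mono[OF ev]) auto
  ultimately show ?thesis
    by (cases "clarke_deriv \<psi> z w") (auto simp: abs_le_iff)
qed

lemma locally_LipschitzE:
  assumes "locally_Lipschitz \<psi>"
  obtains U L where "open U" "z \<in> U" "0 < L" "L-lipschitz_on U \<psi>"
  using assms unfolding locally_Lipschitz_def by meson

text \<open>Junk value \<open>0\<close> where Clarke's derivative is infinite.\<close>

definition clarke_dd :: "('a::real_normed_vector \<Rightarrow> real) \<Rightarrow> 'a \<Rightarrow> 'a \<Rightarrow> real" where
  "clarke_dd \<psi> z w = real_of_ereal (clarke_deriv \<psi> z w)"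

lemma clarke_deriv_eq_dd:
  assumes "locally_Lipschitz \<psi>"
  shows "clarke_deriv \<psi> z w = ereal (clarke_dd \<psi> z w)"
proof -
  obtain U L where "open U" "z \<in> U" "L-lipschitz_on U \<psi>"
    using locally_LipschitzE[OF assms] by metis
  from clarke_deriv_bounded[OF this, of w] show ?thesis
    unfolding clarke_dd_def by (cases "clarke_deriv \<psi> z w") auto
qed

lemma clarke_dd_bounded:
  assumes "locally_Lipschitz \<psi>"
  obtains L where "0 < L" "\<And>w. \<bar>clarke_dd \<psi> z w\<bar> \<le> L * norm w"
proof -
  obtain U L where "open U" "z \<in> U" "0 < L" "L-lipschitz_on U \<psi>"
    using locally_LipschitzE[OF assms] by metis
  with clarke_deriv_bounded[of U z L \<psi>] that[of L] show ?thesis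
    by (simp add: clarke_deriv_eq_dd[OF assms])
qed

section \<open>Sublinearity in the direction\<close>

lemma clarke_dd_lessD:
  assumes "locally_Lipschitz \<psi>" "clarke_dd \<psi> z w < c"
  shows "\<forall>\<^sub>F (u, t) in nhds z \<times>\<^sub>F at_right 0. (\<psi> (u + t *\<^sub>R w) - \<psi> u) / t < c"
  using assms by (intro clarke_deriv_lessD) (simp add: clarke_deriv_eq_dd)

lemma clarke_dd_leI:
  assumes "locally_Lipschitz \<psi>" "\<And>y. c < y \<Longrightarrow>
    \<forall>\<^sub>F (u, t) in nhds z \<times>\<^sub>F at_right 0. (\<psi> (u + t *\<^sub>R w) - \<psi> u) / t < y"
  shows "clarke_dd \<psi> z w \<le> c"
  using clarke_deriv_leI[OF assms(2)] by (simp add: clarke_deriv_eq_dd[OF assms(1)])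

text \<open>The increment along \<open>v + w\<close> is split at \<open>u + t *\<^sub>R v\<close>.
  The second piece starts from a shifted base point, which is harmless because Clarke's upper limit
  also varies the base point.\<close>

lemma clarke_dd_add:
  assumes "locally_Lipschitz \<psi>"
  shows "clarke_dd \<psi> z (v + w) \<le> clarke_dd \<psi> z v + clarke_dd \<psi> z w"
proof (rule clarke_dd_leI[OF assms])
  fix y
  assume y: "clarke_dd \<psi> z v + clarke_dd \<psi> z w < y"
  \<comment> \<open>Half of the slack, one half for each of the two quotients.\<close>
  define d where "d = (y - clarke_dd \<psi> z v - clarke_dd \<psi> z w) / 2"
  have v: "\<forall>\<^sub>F (u, t) in nhds z \<times>\<^sub>F at_right 0.
      (\<psi> (u + t *\<^sub>R v) - \<psi> u) / t < clarke_dd \<psi> z v + d"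
    by (rule clarke_dd_lessD[OF assms]) (use y in \<open>simp add: d_def\<close>)
  have w: "\<forall>\<^sub>F (u, t) in nhds z \<times>\<^sub>F at_right 0.
      (\<psi> (u + t *\<^sub>R w) - \<psi> u) / t < clarke_dd \<psi> z w + d"
    by (rule clarke_dd_lessD[OF assms]) (use y in \<open>simp add: d_def\<close>)
  have "LIM (u, t) nhds z \<times>\<^sub>F at_right 0. (u + t *\<^sub>R v, t) :> nhds z \<times>\<^sub>F at_right 0"
    using filterlim_Pair[OF tendsto_shift filterlim_snd, of v z] by (simp add: case_prod_unfold)
  from this[unfolded filterlim_iff, rule_format, OF w] v
  show "\<forall>\<^sub>F (u, t) in nhds z \<times>\<^sub>F at_right 0. (\<psi> (u + t *\<^sub>R (v + w)) - \<psi> u) / t < y"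
  proof eventually_elim
    case (elim x)
    obtain u t where x: "x = (u, t)" by fastforce
    have "(\<psi> (u + t *\<^sub>R (v + w)) - \<psi> u) / t
        = (\<psi> (u + t *\<^sub>R v + t *\<^sub>R w) - \<psi> (u + t *\<^sub>R v)) / t + (\<psi> (u + t *\<^sub>R v) - \<psi> u) / t"
      by (simp add: scaleR_add_right add.assoc flip: add_divide_distrib)
    also have "\<dots> < (clarke_dd \<psi> z w + d) + (clarke_dd \<psi> z v + d)"
      using elim by (intro add_strict_mono) (auto simp: x)
    finally show ?case by (simp add: x d_def field_simps)
  qed
qed

text \<open>The step length \<open>t\<close> is replaced by \<open>c * t\<close>, which also tends
  to 0 from the right.\<close>

lemma clarke_dd_scale_le:
  assumes "locally_Lipschitz \<psi>" "0 < c"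
  shows "clarke_dd \<psi> z (c *\<^sub>R w) \<le> c * clarke_dd \<psi> z w"
proof (rule clarke_dd_leI[OF assms(1)])
  fix y
  assume y: "c * clarke_dd \<psi> z w < y"
  have w: "\<forall>\<^sub>F (u, t) in nhds z \<times>\<^sub>F at_right 0. (\<psi> (u + t *\<^sub>R w) - \<psi> u) / t < y / c"
    by (rule clarke_dd_lessD[OF assms(1)]) (use y assms(2) in \<open>simp add: field_simps\<close>)
  have "LIM t at_right 0. c * t :> at_right 0"
    by (rule filterlim_times_pos[OF filterlim_ident assms(2)]) simp
  from filterlim_Pair[OF filterlim_fst filterlim_compose[OF this filterlim_snd], of "nhds z"]
  have "LIM (u, t) nhds z \<times>\<^sub>F at_right 0. (u, c * t) :> nhds z \<times>\<^sub>F at_right 0"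
    by (simp add: case_prod_unfold)
  from this[unfolded filterlim_iff, rule_format, OF w] eventually_snd_pos
  show "\<forall>\<^sub>F (u, t) in nhds z \<times>\<^sub>F at_right 0. (\<psi> (u + t *\<^sub>R (c *\<^sub>R w)) - \<psi> u) / t < y"
  proof eventually_elim
    case (elim x)
    obtain u t where x: "x = (u, t)" by fastforce
    have "(\<psi> (u + t *\<^sub>R (c *\<^sub>R w)) - \<psi> u) / t = c * ((\<psi> (u + (c * t) *\<^sub>R w) - \<psi> u) / (c * t))"
      using assms(2) by (simp add: mult.commute[of t c])
    also have "\<dots> < c * (y / c)"
      using elim assms(2) by (intro mult_strict_left_mono) (auto simp: x)
    finally show ?case
      using assms(2) by (simp add: x)
  qed
qed

lemma clarke_dd_scale:
  assumes "locally_Lipschitz \<psi>" "0 < c"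
  shows "clarke_dd \<psi> z (c *\<^sub>R w) = c * clarke_dd \<psi> z w"
proof (rule antisym)
  show "clarke_dd \<psi> z (c *\<^sub>R w) \<le> c * clarke_dd \<psi> z w"
    by (rule clarke_dd_scale_le[OF assms])
  \<comment> \<open>The reverse inequality is the same bound for the factor \<open>1 / c\<close> and
    the direction \<open>c *\<^sub>R w\<close>.\<close>
  have "clarke_dd \<psi> z ((1 / c) *\<^sub>R (c *\<^sub>R w)) \<le> 1 / c * clarke_dd \<psi> z (c *\<^sub>R w)"
    using assms(2) by (intro clarke_dd_scale_le[OF assms(1)]) simp
  then show "c * clarke_dd \<psi> z w \<le> clarke_dd \<psi> z (c *\<^sub>R w)"
    using assms(2) by (simp add: field_simps)
qed

section \<open>The Clarke gradient and its support function\<close>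

lemma clarke_grad_iff:
  assumes "locally_Lipschitz \<psi>"
  shows "v \<in> clarke_grad \<psi> z \<longleftrightarrow> (\<forall>w. v \<bullet> w \<le> clarke_dd \<psi> z w)"
  by (simp add: clarke_grad_def clarke_deriv_eq_dd[OF assms])

text \<open>Hahn-Banach in finite dimension: a hyperplane separating the epigraph of
  \<open>q\<close> from the open vertical ray below \<open>(w\<^sub>0, q w\<^sub>0)\<close> is the
  graph of an affine minorant touching \<open>q\<close> at \<open>w\<^sub>0\<close>. Homogeneity
  makes this minorant linear.\<close>

lemma sublinear_support:
  fixes q :: "'a::euclidean_space \<Rightarrow> real"
  assumes add: "\<And>v w. q (v + w) \<le> q v + q w"
    and scale: "\<And>c w. 0 < c \<Longrightarrow> q (c *\<^sub>R w) = c * q w"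
  obtains v where "\<And>w. v \<bullet> w \<le> q w" "v \<bullet> w\<^sub>0 = q w\<^sub>0"
proof -
  have q0: "q 0 = 0"
    using scale[of 2 0] by simp
  have scale': "q (c *\<^sub>R w) = c * q w" if "0 \<le> c" for c w
    using that scale[of c w] q0 by (cases "c = 0") auto
  define S where "S = {(w, r). q w \<le> r}"
  define T where "T = {(w, r). w = w\<^sub>0 \<and> r < q w\<^sub>0}"
  have "convex S"
    unfolding convex_alt S_def
  proof (clarsimp)
    fix a r b s and c :: real
    assume *: "q a \<le> r" "q b \<le> s" "0 \<le> c" "c \<le> 1"
    have "q ((1 - c) *\<^sub>R a + c *\<^sub>R b) \<le> (1 - c) * q a + c * q b"
      using add[of "(1 - c) *\<^sub>R a" "c *\<^sub>R b"] * by (simp add: scale')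
    also have "\<dots> \<le> (1 - c) * r + c * s"
      using * by (intro add_mono mult_left_mono) auto
    finally show "q ((1 - c) *\<^sub>R a + c *\<^sub>R b) \<le> (1 - c) * r + c * s" .
  qed
  moreover have "T = {w\<^sub>0} \<times> {..<q w\<^sub>0}"
    by (auto simp: T_def)
  then have "convex T"
    by (simp add: convex_Times)
  moreover have "(w\<^sub>0, q w\<^sub>0) \<in> S" "(w\<^sub>0, q w\<^sub>0 - 1) \<in> T" "T \<inter> S = {}"
    by (auto simp: S_def T_def)
  ultimately obtain a b where ab: "a \<noteq> 0" "\<forall>x\<in>T. a \<bullet> x \<le> b" "\<forall>x\<in>S. b \<le> a \<bullet> x"
    using separating_hyperplane_sets[of T S] by blast
  obtain \<alpha> \<beta> where a: "a = (\<alpha>, \<beta>)" by fastforce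
  have T: "\<alpha> \<bullet> w\<^sub>0 + \<beta> * r \<le> b" if "r < q w\<^sub>0" for r
    using ab(2) that by (auto simp: T_def a inner_prod_def)
  have S: "b \<le> \<alpha> \<bullet> w + \<beta> * q w" for w
    using ab(3) by (auto simp: S_def a inner_prod_def)
  have le: "\<alpha> \<bullet> w\<^sub>0 + \<beta> * r \<le> \<alpha> \<bullet> w + \<beta> * q w" if "r < q w\<^sub>0" for r w
    using T[OF that] S[of w] by linarith
  have "0 \<le> \<beta>"
    using le[of "q w\<^sub>0 - 1" w\<^sub>0] by (simp add: algebra_simps)
  moreover have "\<beta> \<noteq> 0"
  proof
    assume "\<beta> = 0"
    then have "\<alpha> \<bullet> w\<^sub>0 \<le> \<alpha> \<bullet> w" for w
      using le[of "q w\<^sub>0 - 1" w] by simp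
    \<comment> \<open>A vertical hyperplane is excluded: a linear functional with a minimum at
      \<open>w\<^sub>0\<close> vanishes, as the move by \<open>- \<alpha>\<close> shows, and then
      the normal \<open>a\<close> would be 0.\<close>
    from this[of "w\<^sub>0 - \<alpha>"] have "\<alpha> \<bullet> \<alpha> \<le> 0"
      by (simp add: inner_diff_right)
    then have "\<alpha> = 0"
      by (metis antisym inner_eq_zero_iff inner_ge_zero)
    with \<open>\<beta> = 0\<close> ab(1) show False
      by (simp add: a zero_prod_def)
  qed
  ultimately have \<beta>: "0 < \<beta>" by simp
  \<comment> \<open>The slope of the separating hyperplane; the next claim says that it is a
    subgradient of \<open>q\<close> at \<open>w\<^sub>0\<close>.\<close>
  define v where "v = (- 1 / \<beta>) *\<^sub>R \<alpha>"
  have le': "q w\<^sub>0 + v \<bullet> (w - w\<^sub>0) \<le> q w" for w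
  proof (rule ccontr)
    assume "\<not> ?thesis"
    then have "q w - v \<bullet> (w - w\<^sub>0) < q w\<^sub>0" by simp
    then obtain r where r: "q w - v \<bullet> (w - w\<^sub>0) < r" "r < q w\<^sub>0"
      using dense by blast
    have "\<beta> * r \<le> \<beta> * (q w - v \<bullet> (w - w\<^sub>0))"
      using le[OF r(2), of w] \<beta> by (simp add: v_def inner_diff_right algebra_simps)
    with r(1) \<beta> show False by simp
  qed
  \<comment> \<open>The points 0 and \<open>2 *\<^sub>R w\<^sub>0\<close> on the ray through
    \<open>w\<^sub>0\<close> give the two opposite inequalities.\<close>
  have "v \<bullet> w\<^sub>0 = q w\<^sub>0"
    using le'[of 0] le'[of "2 *\<^sub>R w\<^sub>0"] q0 scale[of 2 w\<^sub>0]
    by (simp add: inner_diff_right)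
  moreover have "v \<bullet> w \<le> q w" for w
    using le'[of w] calculation by (simp add: inner_diff_right)
  ultimately show thesis using that by blast
qed

text \<open>By sublinearity a linear functional below Clarke's derivative touches it at the given
  \<open>w\<close>, and such a functional is an element of the gradient.\<close>

lemma clarke_grad_support:
  fixes \<psi> :: "'a::euclidean_space \<Rightarrow> real"
  assumes "locally_Lipschitz \<psi>"
  obtains v where "v \<in> clarke_grad \<psi> z" "v \<bullet> w = clarke_dd \<psi> z w"
proof (rule sublinear_support[of "clarke_dd \<psi> z" w])
  show "clarke_dd \<psi> z (v + w) \<le> clarke_dd \<psi> z v + clarke_dd \<psi> z w" for v w
    by (rule clarke_dd_add[OF assms])
  show "clarke_dd \<psi> z (c *\<^sub>R w) = c * clarke_dd \<psi> z w" if "0 < c" for c w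
    using that by (rule clarke_dd_scale[OF assms])
qed (use that in \<open>auto simp: clarke_grad_iff[OF assms]\<close>)

lemma clarke_grad_nonempty:
  fixes \<psi> :: "'a::euclidean_space \<Rightarrow> real"
  assumes "locally_Lipschitz \<psi>"
  shows "clarke_grad \<psi> z \<noteq> {}"
  using clarke_grad_support[OF assms] by blast

text \<open>As an intersection of closed half-spaces the gradient is visibly convex and
  closed.\<close>

lemma clarke_grad_eq_Inter:
  assumes "locally_Lipschitz \<psi>"
  shows "clarke_grad \<psi> z = (\<Inter>w. {v. w \<bullet> v \<le> clarke_dd \<psi> z w})"
  using clarke_grad_iff[OF assms] by (auto simp: inner_commute)

lemma convex_clarke_grad: "locally_Lipschitz \<psi> \<Longrightarrow> convex (clarke_grad \<psi> z)"
  unfolding clarke_grad_eq_Inter by (intro convex_INT convex_halfspace_le)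

lemma compact_clarke_grad:
  fixes \<psi> :: "'a::euclidean_space \<Rightarrow> real"
  assumes "locally_Lipschitz \<psi>"
  shows "compact (clarke_grad \<psi> z)"
proof -
  obtain L where L: "0 < L" "\<And>w. \<bar>clarke_dd \<psi> z w\<bar> \<le> L * norm w"
    using clarke_dd_bounded[OF assms] by metis
  have "norm v \<le> L" if "v \<in> clarke_grad \<psi> z" for v
  proof -
    \<comment> \<open>Testing \<open>v\<close> in its own direction bounds its norm by the Lipschitz
      constant.\<close>
    have "v \<bullet> v \<le> L * norm v"
      using that[unfolded clarke_grad_iff[OF assms], rule_format, of v] L(2)[of v] by linarith
    then have "norm v * norm v \<le> L * norm v"
      by (simp add: power2_norm_eq_inner flip: power2_eq_square)
    then show ?thesis
      using L(1) by (cases "v = 0") auto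
  qed
  then have "bounded (clarke_grad \<psi> z)"
    by (auto simp: bounded_iff)
  moreover have "closed (clarke_grad \<psi> z)"
    unfolding clarke_grad_eq_Inter[OF assms] by (intro closed_INT ballI closed_halfspace_le)
  ultimately show ?thesis
    by (simp add: compact_eq_bounded_closed)
qed

section \<open>Multipliers from a separation argument\<close>

text \<open>Suppose no convex combination of the perturbed gradients is 0. Then a single direction
  strictly decreases all the functions \<open>f a\<close> with their norm terms, whereas
  \<open>min\<close> makes at least one of them not decrease at each nearby point.\<close>

lemma clarke_multipliers:
  fixes f :: "'i \<Rightarrow> 'a::euclidean_space \<Rightarrow> real" and e :: "'i \<Rightarrow> real"
  assumes A: "finite A" "A \<noteq> {}"
    and lip: "\<And>a. a \<in> A \<Longrightarrow> locally_Lipschitz (f a)"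
    and e: "\<And>a. a \<in> A \<Longrightarrow> 0 \<le> e a"
    and min: "\<forall>\<^sub>F x in nhds z. \<exists>a\<in>A. f a z \<le> f a x + e a * norm (x - z)"
  shows "\<exists>c v b. (\<forall>a\<in>A. 0 \<le> c a \<and> v a \<in> clarke_grad (f a) z \<and> norm (b a) \<le> e a) \<and>
    sum c A = 1 \<and> (\<Sum>a\<in>A. c a *\<^sub>R (v a + b a)) = 0"
proof -
  \<comment> \<open>The ball of radius \<open>e a\<close> accounts for the term
    \<open>e a * norm (x - z)\<close>. Each \<open>D a\<close> is compact and convex, so the hull of
    their finite union is closed and can be separated from 0.\<close>
  define D where "D = (\<lambda>a. {v + b |v b. v \<in> clarke_grad (f a) z \<and> b \<in> cball 0 (e a)})"
  have D: "convex (D a)" "compact (D a)" "D a \<noteq> {}" if "a \<in> A" for a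
  proof -
    have eq: "D a = (\<Union>v\<in>clarke_grad (f a) z. \<Union>b\<in>cball 0 (e a). {v + b})"
      unfolding D_def by blast
    show "convex (D a)"
      unfolding eq by (intro convex_sums convex_clarke_grad lip that convex_cball)
    show "compact (D a)"
      unfolding D_def by (intro compact_sums compact_clarke_grad lip that compact_cball)
    have "0 \<in> cball (0::'a) (e a)"
      using e[OF that] by simp
    then show "D a \<noteq> {}"
      using clarke_grad_nonempty[OF lip[OF that], of z] unfolding eq by blast
  qed
  have "0 \<in> convex hull (\<Union>(D ` A))"
  proof (rule ccontr)
    assume "0 \<notin> convex hull (\<Union>(D ` A))"
    moreover have "closed (convex hull (\<Union>(D ` A)))"
      using D A by (intro compact_imp_closed compact_convex_hull compact_UN) auto
    ultimately obtain w\<^sub>0 b where w0: "0 < b" "\<And>x. x \<in> convex hull (\<Union>(D ` A)) \<Longrightarrow> b < w\<^sub>0 \<bullet> x"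
      using separating_hyperplane_closed_0[OF convex_convex_hull] by blast
    define w where "w = - w\<^sub>0"
    have neg: "clarke_dd (f a) z w < - (e a * norm w)" if a: "a \<in> A" for a
    proof -
      obtain v where v: "v \<in> clarke_grad (f a) z" "v \<bullet> w = clarke_dd (f a) z w"
        using clarke_grad_support[OF lip[OF a]] by metis
      \<comment> \<open>Among the vectors of the ball this one has the largest inner product with
        \<open>w\<close>, namely \<open>e a * norm w\<close>; together with the maximising
        \<open>v\<close> it gives the strict bound.\<close>
      have "e a *\<^sub>R sgn w \<in> cball 0 (e a)"
        using e[OF a] by (simp add: norm_sgn)
      then have "v + e a *\<^sub>R sgn w \<in> D a"
        using v(1) unfolding D_def by blast
      then have "0 < w\<^sub>0 \<bullet> (v + e a *\<^sub>R sgn w)"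
        using w0 a by (meson UN_I hull_inc less_trans)
      then have "v \<bullet> w + e a * (sgn w \<bullet> w) < 0"
        unfolding w_def by (simp add: inner_add_right inner_commute)
      moreover have "sgn w \<bullet> w = norm w"
        by (cases "w = 0") (simp_all add: sgn_div_norm dot_square_norm power2_eq_square)
      ultimately show ?thesis
        using v(2) by simp
    qed
    have "\<forall>\<^sub>F t in at_right (0::real). f a (z + t *\<^sub>R w) + e a * norm (t *\<^sub>R w) < f a z"
      if a: "a \<in> A" for a
    proof -
      \<comment> \<open>The joint limit is restricted to the fixed base point \<open>z\<close>, so
        that the bound on the derivative becomes descent along one ray.\<close>
      have "LIM t at_right (0::real). (z, t) :> nhds z \<times>\<^sub>F at_right 0"
        by (intro filterlim_Pair tendsto_const filterlim_ident)
      from this[unfolded filterlim_iff, rule_format, OF clarke_dd_lessD[OF lip[OF a] neg[OF a]]]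
        eventually_at_right_less[of "0::real"]
      show ?thesis
        by eventually_elim (simp add: field_simps)
    qed
    then have "\<forall>\<^sub>F t in at_right (0::real).
        \<forall>a\<in>A. f a (z + t *\<^sub>R w) + e a * norm (t *\<^sub>R w) < f a z"
      using A(1) by (simp add: eventually_ball_finite_distrib)
    moreover have "((\<lambda>t. z + t *\<^sub>R w) \<longlongrightarrow> z) (at_right 0)"
      by (auto intro!: tendsto_eq_intros)
    from this[unfolded filterlim_iff, rule_format, OF min]
    have "\<forall>\<^sub>F t in at_right (0::real).
        \<exists>a\<in>A. f a z \<le> f a (z + t *\<^sub>R w) + e a * norm (t *\<^sub>R w)"
      by simp
    ultimately have "\<forall>\<^sub>F t in at_right (0::real). False"
      by eventually_elim (auto simp: not_less[symmetric])
    then show False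
      by simp
  qed
  \<comment> \<open>Since each \<open>D a\<close> is convex, one point from each of them suffices,
    which yields exactly one multiplier per function.\<close>
  also have "convex hull (\<Union>(D ` A)) =
      {\<Sum>a\<in>A. c a *\<^sub>R s a |c s. (\<forall>a\<in>A. 0 \<le> c a) \<and> sum c A = 1 \<and> (\<forall>a\<in>A. s a \<in> D a)}"
    by (rule convex_hull_finite_union) (use A D in auto)
  finally obtain c s where cs: "(\<Sum>a\<in>A. c a *\<^sub>R s a) = 0" "\<forall>a\<in>A. 0 \<le> c a" "sum c A = 1"
    "\<forall>a\<in>A. s a \<in> D a" by auto
  from cs(4) have "\<forall>a\<in>A. \<exists>v b. s a = v + b \<and> v \<in> clarke_grad (f a) z \<and> norm b \<le> e a"
    by (auto simp: D_def)
  then obtain v b where "\<forall>a\<in>A. s a = v a + b a \<and> v a \<in> clarke_grad (f a) z \<and> norm (b a) \<le> e a"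
    by metis
  with cs show ?thesis
    by (intro exI[of _ c] exI[of _ v] exI[of _ b]) auto
qed

section \<open>Intervals and continuity of the constraints\<close>

lemma half_width_plus: "half_width (Q + R) = half_width Q + half_width R"
  and center_plus: "center (Q + R) = center Q + center R"
  by (simp_all add: half_width_def center_def field_simps)

lemma center_half_width_Interval:
  assumes "0 \<le> c"
  shows "center (Interval (0, c)) = c / 2" "half_width (Interval (0, c)) = c / 2"
  using assms by (simp_all add: center_def half_width_def lower.rep_eq upper.rep_eq Interval_inverse)

text \<open>Center and half-width are half the sum and half the difference of the endpoints, so they
  inherit the same constant \<open>L\<close>.\<close>

lemma locally_Lipschitz_center_half_width:
  assumes "locally_Lipschitz_ivl f"
  shows "locally_Lipschitz (\<lambda>x. center (f x))" "locally_Lipschitz (\<lambda>x. half_width (f x))"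
proof -
  have "\<exists>U L. open U \<and> x \<in> U \<and> 0 < L \<and> L-lipschitz_on U (\<lambda>x. center (f x)) \<and>
      L-lipschitz_on U (\<lambda>x. half_width (f x))" for x
  proof -
    obtain U L where U: "open U" "x \<in> U" "0 < L" and L: "\<And>a b. a \<in> U \<Longrightarrow> b \<in> U \<Longrightarrow>
        max \<bar>lower (f a) - lower (f b)\<bar> \<bar>upper (f a) - upper (f b)\<bar> \<le> L * norm (a - b)"
      using assms unfolding locally_Lipschitz_ivl_def by meson
    have bd: "\<bar>lower (f a) - lower (f b)\<bar> \<le> L * dist a b" "\<bar>upper (f a) - upper (f b)\<bar> \<le> L * dist a b"
      if "a \<in> U" "b \<in> U" for a b
      using L[OF that] by (simp_all add: dist_norm)
    have "dist (center (f a)) (center (f b)) \<le> L * dist a b" if "a \<in> U" "b \<in> U" for a b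
      using bd[OF that] by (simp add: dist_real_def center_def abs_le_iff field_simps)
    moreover have "dist (half_width (f a)) (half_width (f b)) \<le> L * dist a b" if "a \<in> U" "b \<in> U" for a b
      using bd[OF that] by (simp add: dist_real_def half_width_def abs_le_iff field_simps)
    ultimately have "L-lipschitz_on U (\<lambda>x. center (f x))" "L-lipschitz_on U (\<lambda>x. half_width (f x))"
      using U(3) by (simp_all add: lipschitz_on_def)
    with U show ?thesis by blast
  qed
  then show "locally_Lipschitz (\<lambda>x. center (f x))" "locally_Lipschitz (\<lambda>x. half_width (f x))"
    unfolding locally_Lipschitz_def by metis+
qed

lemma locally_Lipschitz_isCont:
  assumes "locally_Lipschitz f"
  shows "isCont f x"
proof -
  obtain U L where "open U" "x \<in> U" "L-lipschitz_on U f"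
    using locally_LipschitzE[OF assms] by metis
  then show ?thesis
    using lipschitz_on_continuous_on continuous_on_eq_continuous_at by blast
qed

lemma eventually_inactive_neg:
  assumes "finite J" "\<And>j. j \<in> J \<Longrightarrow> locally_Lipschitz (g j)" "z \<in> feasible_set J g"
  shows "\<forall>\<^sub>F x in nhds z. \<forall>j\<in>J - active_set J g z. g j x < 0"
proof -
  have "\<forall>\<^sub>F x in nhds z. g j x < 0" if "j \<in> J - active_set J g z" for j
  proof -
    have "g j z < 0"
      using that assms(3) by (force simp: active_set_def feasible_set_def)
    moreover have "(g j \<longlongrightarrow> g j z) (nhds z)"
      using locally_Lipschitz_isCont[OF assms(2), of j z] that
      by (simp add: isCont_def tendsto_nhds_iff)
    ultimately show ?thesis
      by (rule order_tendstoD(2)[rotated])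
  qed
  then show ?thesis
    using assms(1) by (simp add: eventually_ball_finite_distrib)
qed

section \<open>Regrouping multipliers in scaled sets\<close>

text \<open>Merges the multipliers of center and half-width into the single multiplier of the
  interval-valued gradient, by normalising the weights unless both vanish.\<close>

lemma scaled_in_hull_Un:
  fixes v w :: "'a::real_vector"
  assumes "v \<in> A" "w \<in> B" "0 \<le> a" "0 \<le> b"
  shows "a *\<^sub>R v + b *\<^sub>R w \<in> (*\<^sub>R) (a + b) ` (convex hull (A \<union> B))"
proof (cases "a + b = 0")
  case True
  then have "a = 0" "b = 0"
    using assms by auto
  then show ?thesis
    using hull_inc[of v "A \<union> B" convex] assms(1) by (auto intro!: image_eqI[of _ _ v])
next
  case False
  let ?y = "(a / (a + b)) *\<^sub>R v + (b / (a + b)) *\<^sub>R w"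
  have "?y \<in> convex hull (A \<union> B)"
    using assms False
    by (intro convexD[OF convex_convex_hull] hull_inc) (auto simp flip: add_divide_distrib)
  moreover have "a *\<^sub>R v + b *\<^sub>R w = (a + b) *\<^sub>R ?y"
    using False by (simp add: scaleR_add_right)
  ultimately show ?thesis by blast
qed

lemma mem_scaled_unit_cball:
  fixes x :: "'a::real_normed_vector"
  assumes "norm x \<le> r"
  shows "x \<in> (*\<^sub>R) r ` cball 0 1"
proof (cases "r = 0")
  case True
  with assms show ?thesis by (auto intro!: image_eqI[of _ _ 0])
next
  case False
  then have "0 < r"
    using assms norm_ge_zero[of x] by linarith
  then show ?thesis
    using assms by (simp add: cball_scale)
qed

section \<open>Optimality conditions for one player\<close>

lemma interval_optimality_conditions:
  fixes \<Phi> :: "nat \<Rightarrow> 'a::euclidean_space \<Rightarrow> real interval"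
  assumes K: "finite K" "K \<noteq> {}" and J: "finite J"
    and \<epsilon>: "\<And>k. k \<in> K \<Longrightarrow> 0 \<le> \<epsilon> k"
    and z: "z \<in> feasible_set J g"
    and opt: "\<And>y. y \<in> feasible_set J g \<Longrightarrow>
      \<exists>k\<in>K. \<not> \<Phi> k y + Interval (0, \<epsilon> k * norm (z - y)) \<prec>\<^sub>C\<^sub>W \<Phi> k z"
    and lip\<Phi>: "\<And>k. k \<in> K \<Longrightarrow> locally_Lipschitz_ivl (\<Phi> k)"
    and lipg: "\<And>j. j \<in> J \<Longrightarrow> locally_Lipschitz (g j)"
    and BCQ: "BCQ J g z"
  obtains lam \<mu> :: "nat \<Rightarrow> real"
    where "\<And>k. k \<in> K \<Longrightarrow> 0 \<le> lam k" "(\<Sum>k\<in>K. lam k) = 1" "\<And>j. j \<in> J \<Longrightarrow> 0 \<le> \<mu> j"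
      "0 \<in> (\<Sum>k\<in>K. (*\<^sub>R) (lam k) ` clarke_grad_ivl (\<Phi> k) z)
         + (\<Sum>j\<in>active_set J g z. (*\<^sub>R) (\<mu> j) ` clarke_grad (g j) z)
         + (\<Sum>k\<in>K. (*\<^sub>R) (lam k * \<epsilon> k) ` cball 0 1)"
      "\<And>j. j \<in> J \<Longrightarrow> \<mu> j * g j z = 0"
proof -
  define I where "I = active_set J g z"
  have I: "finite I" "I \<subseteq> J" "\<And>j. j \<in> I \<Longrightarrow> g j z = 0"
    using J by (auto simp: I_def active_set_def)
  \<comment> \<open>The tags \<open>Inl\<close>, \<open>Inr (Inl _)\<close> and
    \<open>Inr (Inr _)\<close> mark centers, half-widths and constraints.\<close>
  define f where "f = case_sum (\<lambda>k x. center (\<Phi> k x)) (case_sum (\<lambda>k x. half_width (\<Phi> k x)) g)"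
  \<comment> \<open>The value 0 for constraints reduces their balls to the origin, so only
    objectives contribute perturbations.\<close>
  define e where "e = case_sum (\<lambda>k. \<epsilon> k / 2) (case_sum (\<lambda>k. \<epsilon> k / 2) (\<lambda>j::nat. 0))"
  let ?A = "K <+> (K <+> I)"
  have min: "\<forall>\<^sub>F x in nhds z. \<exists>a\<in>?A. f a z \<le> f a x + e a * norm (x - z)"
    using eventually_inactive_neg[of J g, OF J _ z, OF lipg, simplified]
  proof eventually_elim
    case (elim x)
    show ?case
    proof (cases "x \<in> feasible_set J g")
      case True
      then obtain k where k: "k \<in> K" "\<not> \<Phi> k x + Interval (0, \<epsilon> k * norm (z - x)) \<prec>\<^sub>C\<^sub>W \<Phi> k z"
        using opt by blast
      then have "center (\<Phi> k z) \<le> center (\<Phi> k x) + \<epsilon> k / 2 * norm (x - z)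
          \<or> half_width (\<Phi> k z) \<le> half_width (\<Phi> k x) + \<epsilon> k / 2 * norm (x - z)"
        using \<epsilon>[OF k(1)]
        by (simp add: cw_less_def center_plus half_width_plus center_half_width_Interval
            norm_minus_commute not_less)
      then show ?thesis
      proof
        assume "center (\<Phi> k z) \<le> center (\<Phi> k x) + \<epsilon> k / 2 * norm (x - z)"
        then show ?thesis
          using k(1) by (intro bexI[of _ "Inl k"]) (auto simp: f_def e_def)
      next
        assume "half_width (\<Phi> k z) \<le> half_width (\<Phi> k x) + \<epsilon> k / 2 * norm (x - z)"
        then show ?thesis
          using k(1) by (intro bexI[of _ "Inr (Inl k)"]) (auto simp: f_def e_def)
      qed
    next
      case False
      \<comment> \<open>A constraint violated at a nearby point must be active at \<open>z\<close>,
        so its value has risen from 0.\<close>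
      then obtain j where j: "j \<in> J" "0 < g j x"
        by (auto simp: feasible_set_def)
      with elim have "j \<in> I"
        unfolding I_def by force
      with j I(3) show ?thesis
        by (intro bexI[of _ "Inr (Inr j)"]) (auto simp: f_def e_def)
    qed
  qed
  have lip: "locally_Lipschitz (f a)" and e: "0 \<le> e a" if "a \<in> ?A" for a
    using that I(2) locally_Lipschitz_center_half_width[OF lip\<Phi>] lipg \<epsilon>
    by (auto simp: f_def e_def)
  have A: "finite ?A" "?A \<noteq> {}"
    using K I(1) by auto
  obtain c v b where cvb: "\<forall>a\<in>?A. 0 \<le> c a \<and> v a \<in> clarke_grad (f a) z \<and> norm (b a) \<le> e a"
    and c_sum: "sum c ?A = 1" and vb: "(\<Sum>a\<in>?A. c a *\<^sub>R (v a + b a)) = 0"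
    using clarke_multipliers[OF A lip e min] by blast
  define c1 c2 c3 where "c1 = c \<circ> Inl" and "c2 = c \<circ> Inr \<circ> Inl" and "c3 = c \<circ> Inr \<circ> Inr"
  define v1 v2 v3 where "v1 = v \<circ> Inl" and "v2 = v \<circ> Inr \<circ> Inl" and "v3 = v \<circ> Inr \<circ> Inr"
  define b1 b2 where "b1 = b \<circ> Inl" and "b2 = b \<circ> Inr \<circ> Inl"
  note defs = c1_def c2_def c3_def v1_def v2_def v3_def b1_def b2_def
  have c1: "0 \<le> c1 k" and c2: "0 \<le> c2 k"
    and v1: "v1 k \<in> clarke_grad (\<lambda>x. center (\<Phi> k x)) z"
    and v2: "v2 k \<in> clarke_grad (\<lambda>x. half_width (\<Phi> k x)) z"
    and b1: "norm (b1 k) \<le> \<epsilon> k / 2" and b2: "norm (b2 k) \<le> \<epsilon> k / 2" if "k \<in> K" for k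
    using that cvb[rule_format, of "Inl k"] cvb[rule_format, of "Inr (Inl k)"]
    by (auto simp: defs f_def e_def)
  have c3: "0 \<le> c3 j" and v3: "v3 j \<in> clarke_grad (g j) z" and b3: "b (Inr (Inr j)) = 0"
    if "j \<in> I" for j
    using that cvb[rule_format, of "Inr (Inr j)"]
    by (auto simp: defs f_def e_def)
  have sum_c: "(\<Sum>k\<in>K. c1 k + c2 k) + (\<Sum>j\<in>I. c3 j) = 1"
    using c_sum K(1) I(1) by (simp add: sum.Plus defs sum.distrib add.assoc comp_def)
  have sum_v: "(\<Sum>k\<in>K. c1 k *\<^sub>R v1 k + c2 k *\<^sub>R v2 k) + (\<Sum>j\<in>I. c3 j *\<^sub>R v3 j)
      + (\<Sum>k\<in>K. c1 k *\<^sub>R b1 k + c2 k *\<^sub>R b2 k) = 0"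
    using vb K(1) I(1) b3
    by (simp add: sum.Plus defs sum.distrib scaleR_add_right add_ac comp_def)
  \<comment> \<open>The total weight on the objectives. If it were 0, the whole weight 1 would lie
    on active constraints and contradict BCQ.\<close>
  define T where "T = (\<Sum>k\<in>K. c1 k + c2 k)"
  have "T \<noteq> 0"
  proof
    assume T: "T = 0"
    then have c0: "c1 k = 0" "c2 k = 0" if "k \<in> K" for k
      using that K(1) c1 c2 by (auto simp: T_def sum_nonneg_eq_0_iff add_nonneg_eq_0_iff)
    define \<mu> where "\<mu> = (\<lambda>j. if j \<in> I then c3 j else 0)"
    \<comment> \<open>The sum in BCQ runs over all of \<open>J\<close>. For inactive indices some
      gradient element is chosen and scaled by 0; it exists because Clarke gradients are
      nonempty.\<close>
    define s where "s = (\<lambda>j. \<mu> j *\<^sub>R (if j \<in> I then v3 j else (SOME v. v \<in> clarke_grad (g j) z)))"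
    have "\<forall>j\<in>J. s j \<in> (*\<^sub>R) (\<mu> j) ` clarke_grad (g j) z"
      using v3 clarke_grad_nonempty[OF lipg] by (auto simp: s_def some_in_eq intro!: imageI)
    moreover have "sum s J = (\<Sum>j\<in>I. c3 j *\<^sub>R v3 j)"
      using J I(2) by (intro sum.mono_neutral_cong_right) (auto simp: s_def \<mu>_def)
    then have "sum s J = 0"
      using sum_v c0 by simp
    ultimately have "0 \<in> (\<Sum>j\<in>J. (*\<^sub>R) (\<mu> j) ` clarke_grad (g j) z)"
      unfolding set_sum_alt[OF J] by (force intro: exI[of _ s])
    moreover have "\<exists>j\<in>J. \<mu> j \<noteq> 0"
    proof (rule ccontr)
      assume "\<not> ?thesis"
      then have "(\<Sum>j\<in>I. c3 j) = 0"
        using I(2) by (intro sum.neutral) (force simp: \<mu>_def)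
      with sum_c T show False
        by (simp add: T_def)
    qed
    moreover have "\<forall>j\<in>J. 0 \<le> \<mu> j" "\<forall>j\<in>J - active_set J g z. \<mu> j = 0"
      using c3 by (auto simp: \<mu>_def I_def)
    ultimately show False
      using BCQ unfolding BCQ_def by blast
  qed
  moreover have "0 \<le> T"
    unfolding T_def using c1 c2 by (intro sum_nonneg add_nonneg_nonneg)
  ultimately have T: "0 < T" by simp
  \<comment> \<open>Division by \<open>T\<close> normalises the weights on the objectives to total
    1.\<close>
  define lam where "lam = (\<lambda>k. c1 k / T + c2 k / T)"
  define \<mu> where "\<mu> = (\<lambda>j. if j \<in> I then c3 j / T else 0)"
  define p q r where "p = (\<lambda>k. (c1 k / T) *\<^sub>R v1 k + (c2 k / T) *\<^sub>R v2 k)"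
    and "q = (\<lambda>j. \<mu> j *\<^sub>R v3 j)"
    and "r = (\<lambda>k. (c1 k / T) *\<^sub>R b1 k + (c2 k / T) *\<^sub>R b2 k)"
  have p: "p k \<in> (*\<^sub>R) (lam k) ` clarke_grad_ivl (\<Phi> k) z" if "k \<in> K" for k
    unfolding p_def lam_def clarke_grad_ivl_def
    using that T by (intro scaled_in_hull_Un v1 v2 divide_nonneg_pos c1 c2)
  have q: "q j \<in> (*\<^sub>R) (\<mu> j) ` clarke_grad (g j) z" if "j \<in> I" for j
    using that v3 by (auto simp: q_def)
  have r: "r k \<in> (*\<^sub>R) (lam k * \<epsilon> k) ` cball 0 1" if k: "k \<in> K" for k
  proof (rule mem_scaled_unit_cball)
    \<comment> \<open>Since \<open>\<epsilon> k\<close> is nonnegative, the ball of radius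
      \<open>\<epsilon> k / 2\<close> lies in that of radius \<open>\<epsilon> k\<close>.\<close>
    have le: "norm (a *\<^sub>R x) \<le> a * \<epsilon> k" if "norm x \<le> \<epsilon> k / 2" "0 \<le> a" for a and x :: 'a
      using mult_left_mono[of "norm x" "\<epsilon> k" a] that \<epsilon>[OF k] by simp
    have "norm (r k) \<le> c1 k / T * \<epsilon> k + c2 k / T * \<epsilon> k"
      unfolding r_def using k T b1 b2 c1 c2
      by (intro norm_triangle_le add_mono le divide_nonneg_pos)
    then show "norm (r k) \<le> lam k * \<epsilon> k"
      by (simp add: lam_def distrib_right)
  qed
  have "sum p K + sum q I + sum r K = (1 / T) *\<^sub>R ((\<Sum>k\<in>K. c1 k *\<^sub>R v1 k + c2 k *\<^sub>R v2 k)
      + (\<Sum>j\<in>I. c3 j *\<^sub>R v3 j) + (\<Sum>k\<in>K. c1 k *\<^sub>R b1 k + c2 k *\<^sub>R b2 k))"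
    by (simp add: p_def q_def r_def \<mu>_def scaleR_add_right scaleR_sum_right)
  then have "0 = sum p K + sum q I + sum r K"
    using sum_v by simp
  also have "\<dots> \<in> (\<Sum>k\<in>K. (*\<^sub>R) (lam k) ` clarke_grad_ivl (\<Phi> k) z)
       + (\<Sum>j\<in>I. (*\<^sub>R) (\<mu> j) ` clarke_grad (g j) z)
       + (\<Sum>k\<in>K. (*\<^sub>R) (lam k * \<epsilon> k) ` cball 0 1)"
    unfolding set_sum_alt[OF K(1)] set_sum_alt[OF I(1)]
    using p q r by (intro set_plus_intro) blast+
  finally have "0 \<in> (\<Sum>k\<in>K. (*\<^sub>R) (lam k) ` clarke_grad_ivl (\<Phi> k) z)
       + (\<Sum>j\<in>active_set J g z. (*\<^sub>R) (\<mu> j) ` clarke_grad (g j) z)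
       + (\<Sum>k\<in>K. (*\<^sub>R) (lam k * \<epsilon> k) ` cball 0 1)"
    unfolding I_def .
  moreover have "(\<Sum>k\<in>K. lam k) = 1"
    using T by (simp add: lam_def T_def flip: add_divide_distrib sum_divide_distrib)
  moreover have "0 \<le> lam k" if "k \<in> K" for k
    using that c1 c2 T by (simp add: lam_def)
  moreover have "0 \<le> \<mu> j" "\<mu> j * g j z = 0" for j
    using c3 T I(3) by (auto simp: \<mu>_def)
  ultimately show thesis
    by (intro that[of lam \<mu>])
qed

section \<open>Application to each player of the game\<close>

theorem theorem5p2:
  fixes l m p :: nat
    and \<Lambda> J K :: "nat set"
    and g :: "nat \<Rightarrow> nat \<Rightarrow> real ^ 'n \<Rightarrow> real"
    and F :: "nat \<Rightarrow> nat \<Rightarrow> (nat \<Rightarrow> real ^ 'n) \<Rightarrow> real interval"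
    and S :: "nat \<Rightarrow> (real ^ 'n) set"
    and \<epsilon> :: "nat \<Rightarrow> real"
    and u :: "nat \<Rightarrow> real ^ 'n"
  assumes "\<Lambda> = {1..l}" and "J = {1..p}" and "K = {1..m}"
    and "\<And>i. i \<in> \<Lambda> \<Longrightarrow> S i = feasible_set J (g i)"
    and "\<forall>k\<in>K. 0 \<le> \<epsilon> k" and "\<exists>k\<in>K. \<epsilon> k \<noteq> 0"
    and "weak_quasi_Nash \<Lambda> K S F \<epsilon> u"
    and "\<And>i k. i \<in> \<Lambda> \<Longrightarrow> k \<in> K \<Longrightarrow> locally_Lipschitz_ivl (\<lambda>x. F i k (u(i := x)))"
    and "\<And>i j. i \<in> \<Lambda> \<Longrightarrow> j \<in> J \<Longrightarrow> locally_Lipschitz (g i j)"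
    and "\<And>i. i \<in> \<Lambda> \<Longrightarrow> BCQ J (g i) (u i)"
  shows "\<forall>i\<in>\<Lambda>. \<exists>lam \<mu> :: nat \<Rightarrow> real.
           (\<forall>k\<in>K. 0 \<le> lam k) \<and> (\<Sum>k\<in>K. lam k) = 1 \<and> (\<forall>j\<in>J. 0 \<le> \<mu> j) \<and>
           0 \<in> (\<Sum>k\<in>K. (*\<^sub>R) (lam k) ` clarke_grad_ivl (\<lambda>x. F i k (u(i := x))) (u i))
             + (\<Sum>j\<in>active_set J (g i) (u i). (*\<^sub>R) (\<mu> j) ` clarke_grad (g i j) (u i))
             + (\<Sum>k\<in>K. (*\<^sub>R) (lam k * \<epsilon> k) ` cball 0 1) \<and>
           (\<forall>j\<in>J. \<mu> j * g i j (u i) = 0)"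
proof
  fix i
  assume i: "i \<in> \<Lambda>"
  have S: "S i = feasible_set J (g i)"
    using assms(4)[OF i] .
  have u: "u i \<in> S i"
    and opt: "\<And>y. y \<in> S i \<Longrightarrow>
      \<exists>k\<in>K. \<not> F i k (u(i := y)) + Interval (0, \<epsilon> k * norm (u i - y)) \<prec>\<^sub>C\<^sub>W F i k u"
    using assms(7) i unfolding weak_quasi_Nash_def by (auto simp: PiE_iff)
  \<comment> \<open>\<open>K\<close> is nonempty because some \<open>\<epsilon> k\<close> is
    nonzero.\<close>
  have fin: "finite K" "finite J" "K \<noteq> {}"
    using assms(2,3,6) by auto
  show "\<exists>lam \<mu> :: nat \<Rightarrow> real.
           (\<forall>k\<in>K. 0 \<le> lam k) \<and> (\<Sum>k\<in>K. lam k) = 1 \<and> (\<forall>j\<in>J. 0 \<le> \<mu> j) \<and>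
           0 \<in> (\<Sum>k\<in>K. (*\<^sub>R) (lam k) ` clarke_grad_ivl (\<lambda>x. F i k (u(i := x))) (u i))
             + (\<Sum>j\<in>active_set J (g i) (u i). (*\<^sub>R) (\<mu> j) ` clarke_grad (g i j) (u i))
             + (\<Sum>k\<in>K. (*\<^sub>R) (lam k * \<epsilon> k) ` cball 0 1) \<and>
           (\<forall>j\<in>J. \<mu> j * g i j (u i) = 0)"
    \<comment> \<open>The other players' strategies are frozen; at \<open>x = u i\<close> the
      updated profile is \<open>u\<close> itself.\<close>
    by (rule interval_optimality_conditions
        [of K J \<epsilon> "u i" "g i" "\<lambda>k x. F i k (u(i := x))"])
      (use fin i u S opt assms(5,8,9,10) in \<open>(simp; fail) | blast\<close>)+
qed

end
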